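(* For every computable ordinal $\alpha$ (i.e. $\alpha<\omega_1^{ck}$) there is a linear ordering (with universe $\omega$) that is $\Sigma_{\alpha+2}$-coarsely c.e. but not $\Sigma_{\alpha+2}$-generically c.e.
   Context: $\omega_1^{ck}$ is the least non-computable ordinal. Structures are countable with universe $\omega$ (substructures have universe a subset of $\omega$). Formulas are infinitary formulas of $\mathcal{L}_{\omega_1,\omega}$: $\Sigma_0=\Pi_0$ are the finitary quantifier-free formulas, and for $\gamma\ge 1$ a $\Sigma_\gamma$ formula is a countable disjunction of formulas $\exists \bar x\,\psi$ with $\psi\in\Pi_\beta$, $\beta<\gamma$ (dually for $\Pi_\gamma$). A substructure $\mathcal{B}$ of $\mathcal{A}$ is a $\Sigma_\gamma$ elementary substructure if for every $\Sigma_\gamma$ formula $\phi$ and every tuple $\bar b$ from $\mathcal{B}$, $\mathcal{B}\models\phi(\bar b)\iff\mathcal{A}\models\phi(\bar b)$. A set $D\subseteq\omega$ is dense if $\lim_{n\to\infty}|D\cap\{0,\dots,n\}|/(n+1)=1$. A c.e. substructure is one whose universe is c.e., each of whose relations (restricted to that universe) is c.e., and each of whose functions has c.e. graph. $\mathcal{A}$ is $\Sigma_\gamma$-generically c.e. if there is a dense c.e. set $D$ such that the substructure of $\mathcal{A}$ with universe $D$ is a c.e. substructure and a $\Sigma_\gamma$ elementary substructure of $\mathcal{A}$. $\mathcal{A}$ is $\Sigma_\gamma$-coarsely c.e. if there are a dense set $D$ and a c.e. structure $\mathcal{E}$ (universe $\omega$, relations c.e., graphs of functions c.e.) such that a structure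 $\mathcal{D}$ with universe $D$ is a $\Sigma_\gamma$ elementary substructure of both $\mathcal{A}$ and $\mathcal{E}$. *)

theory Defs
  imports Complex_Main
begin

section \<open>Partial recursive functions and c.e. relations\<close>

datatype recf =
    Zero
  | Succ
  | Proj nat
  | Comp recf "recf list"
  | Prec recf recf
  | Mu recf

text \<open>\<^term>\<open>rec_eval f xs y\<close>: the partial recursive function \<^term>\<open>f\<close> converges on the
  argument tuple \<^term>\<open>xs\<close> with value \<^term>\<open>y\<close>. Recursion and minimisation act on the
  first argument.\<close>

inductive rec_eval :: "recf \<Rightarrow> nat list \<Rightarrow> nat \<Rightarrow> bool" where
  Zero: "rec_eval Zero xs 0"
| Succ: "rec_eval Succ [x] (Suc x)"
| Proj: "i < length xs \<Longrightarrow> rec_eval (Proj i) xs (xs ! i)"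
| Comp: "list_all2 (\<lambda>g y. rec_eval g xs y) gs ys \<Longrightarrow> rec_eval f ys z
    \<Longrightarrow> rec_eval (Comp f gs) xs z"
| Prec_0: "rec_eval f xs y \<Longrightarrow> rec_eval (Prec f g) (0 # xs) y"
| Prec_Suc: "rec_eval (Prec f g) (n # xs) y \<Longrightarrow> rec_eval g (n # y # xs) z
    \<Longrightarrow> rec_eval (Prec f g) (Suc n # xs) z"
| Mu: "rec_eval f (n # xs) 0 \<Longrightarrow> (\<forall>m<n. \<exists>y. rec_eval f (m # xs) (Suc y))
    \<Longrightarrow> rec_eval (Mu f) xs n"

definition ce_rel :: "nat \<Rightarrow> nat list set \<Rightarrow> bool" where
  "ce_rel n R \<longleftrightarrow> R \<subseteq> {xs. length xs = n} \<and>
     (\<exists>f. \<forall>xs. length xs = n \<longrightarrow> (xs \<in> R \<longleftrightarrow> (\<exists>y. rec_eval f xs y)))"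

definition ce_set :: "nat set \<Rightarrow> bool" where
  "ce_set D \<longleftrightarrow> ce_rel 1 {[x] | x. x \<in> D}"

section \<open>Computable ordinals\<close>

text \<open>Countable ordinals are represented by reflexive well-orders on sets of natural numbers,
  compared by \<^const>\<open>ordLess\<close> and \<^const>\<open>ordIso\<close>.\<close>

definition decidable_rel :: "nat rel \<Rightarrow> bool" where
  "decidable_rel r \<longleftrightarrow> (\<exists>f. \<forall>x y. rec_eval f [x, y] (if (x, y) \<in> r then 1 else 0))"

definition computable_ordinal :: "nat rel \<Rightarrow> bool" where
  "computable_ordinal \<alpha> \<longleftrightarrow>
     Well_order \<alpha> \<and> (\<exists>r :: nat rel. Well_order r \<and> decidable_rel r \<and> (\<alpha>, r) \<in> ordIso)"

text \<open>The ordinal successor: \<^term>\<open>r\<close> is shifted to the positive numbers and \<open>0\<close> becomes the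
  new largest element.\<close>

definition ord_succ :: "nat rel \<Rightarrow> nat rel" where
  "ord_succ r = {(Suc x, Suc y) | x y. (x, y) \<in> r} \<union> {(Suc x, 0) | x. x \<in> Field r} \<union> {(0, 0)}"

section \<open>Languages and structures\<close>

text \<open>A symbol belongs to the language iff it is assigned an arity; constants are nullary
  functions.\<close>

record lang =
  fun_ar :: "nat \<rightharpoonup> nat"
  rel_ar :: "nat \<rightharpoonup> nat"

record struct =
  univ :: "nat set"
  fun_of :: "nat \<Rightarrow> nat list \<Rightarrow> nat"
  rel_of :: "nat \<Rightarrow> nat list set"

definition tuples :: "nat set \<Rightarrow> nat \<Rightarrow> nat list set" where
  "tuples D n = {xs. length xs = n \<and> set xs \<subseteq> D}"

definition is_structure :: "lang \<Rightarrow> struct \<Rightarrow> bool" where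
  "is_structure L A \<longleftrightarrow> univ A \<noteq> {} \<and>
     (\<forall>f n. fun_ar L f = Some n \<longrightarrow> (\<forall>xs \<in> tuples (univ A) n. fun_of A f xs \<in> univ A)) \<and>
     (\<forall>R n. rel_ar L R = Some n \<longrightarrow> rel_of A R \<subseteq> tuples (univ A) n)"

definition substructure :: "lang \<Rightarrow> struct \<Rightarrow> struct \<Rightarrow> bool" where
  "substructure L B A \<longleftrightarrow> is_structure L B \<and> is_structure L A \<and> univ B \<subseteq> univ A \<and>
     (\<forall>f n. fun_ar L f = Some n \<longrightarrow> (\<forall>xs \<in> tuples (univ B) n. fun_of B f xs = fun_of A f xs)) \<and>
     (\<forall>R n. rel_ar L R = Some n \<longrightarrow> rel_of B R = rel_of A R \<inter> tuples (univ B) n)"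

text \<open>This is a structure only if \<^term>\<open>D\<close> is nonempty and closed under the functions of
  \<^term>\<open>A\<close>.\<close>

definition restrict_struct :: "struct \<Rightarrow> nat set \<Rightarrow> struct" where
  "restrict_struct A D =
     \<lparr>univ = D, fun_of = fun_of A, rel_of = (\<lambda>R. rel_of A R \<inter> {xs. set xs \<subseteq> D})\<rparr>"

definition ce_structure :: "lang \<Rightarrow> struct \<Rightarrow> bool" where
  "ce_structure L A \<longleftrightarrow> is_structure L A \<and> ce_set (univ A) \<and>
     (\<forall>R n. rel_ar L R = Some n \<longrightarrow> ce_rel n (rel_of A R)) \<and>
     (\<forall>f n. fun_ar L f = Some n \<longrightarrow>
        ce_rel (Suc n) {xs @ [fun_of A f xs] | xs. xs \<in> tuples (univ A) n})"

section \<open>Infinitary formulas\<close>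

datatype trm = Var nat | App nat "trm list"

text \<open>\<^term>\<open>Disj I F\<close> and \<^term>\<open>Conj I F\<close> are the disjunction and conjunction of the formulas
  \<^term>\<open>F i\<close> for \<^term>\<open>i \<in> I\<close>; the values of \<^term>\<open>F\<close> outside \<^term>\<open>I\<close> are ignored.\<close>

datatype fm =
    Eq trm trm
  | Rel nat "trm list"
  | Neg fm
  | Disj "nat set" "nat \<Rightarrow> fm"
  | Conj "nat set" "nat \<Rightarrow> fm"
  | Ex nat fm
  | All nat fm

fun fv_trm :: "trm \<Rightarrow> nat set" where
  "fv_trm (Var x) = {x}"
| "fv_trm (App f ts) = (\<Union>t \<in> set ts. fv_trm t)"

primrec fv :: "fm \<Rightarrow> nat set" where
  "fv (Eq s t) = fv_trm s \<union> fv_trm t"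
| "fv (Rel R ts) = (\<Union>t \<in> set ts. fv_trm t)"
| "fv (Neg \<phi>) = fv \<phi>"
| "fv (Disj I F) = (\<Union>i \<in> I. fv (F i))"
| "fv (Conj I F) = (\<Union>i \<in> I. fv (F i))"
| "fv (Ex x \<phi>) = fv \<phi> - {x}"
| "fv (All x \<phi>) = fv \<phi> - {x}"

fun trm_in :: "lang \<Rightarrow> trm \<Rightarrow> bool" where
  "trm_in L (Var x) \<longleftrightarrow> True"
| "trm_in L (App f ts) \<longleftrightarrow> fun_ar L f = Some (length ts) \<and> (\<forall>t \<in> set ts. trm_in L t)"

primrec fm_in :: "lang \<Rightarrow> fm \<Rightarrow> bool" where
  "fm_in L (Eq s t) \<longleftrightarrow> trm_in L s \<and> trm_in L t"
| "fm_in L (Rel R ts) \<longleftrightarrow> rel_ar L R = Some (length ts) \<and> (\<forall>t \<in> set ts. trm_in L t)"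
| "fm_in L (Neg \<phi>) \<longleftrightarrow> fm_in L \<phi>"
| "fm_in L (Disj I F) \<longleftrightarrow> (\<forall>i \<in> I. fm_in L (F i))"
| "fm_in L (Conj I F) \<longleftrightarrow> (\<forall>i \<in> I. fm_in L (F i))"
| "fm_in L (Ex x \<phi>) \<longleftrightarrow> fm_in L \<phi>"
| "fm_in L (All x \<phi>) \<longleftrightarrow> fm_in L \<phi>"

fun eval_trm :: "struct \<Rightarrow> (nat \<Rightarrow> nat) \<Rightarrow> trm \<Rightarrow> nat" where
  "eval_trm A e (Var x) = e x"
| "eval_trm A e (App f ts) = fun_of A f (map (eval_trm A e) ts)"

primrec sat :: "struct \<Rightarrow> fm \<Rightarrow> (nat \<Rightarrow> nat) \<Rightarrow> bool" where
  "sat A (Eq s t) e \<longleftrightarrow> eval_trm A e s = eval_trm A e t"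
| "sat A (Rel R ts) e \<longleftrightarrow> map (eval_trm A e) ts \<in> rel_of A R"
| "sat A (Neg \<phi>) e \<longleftrightarrow> \<not> sat A \<phi> e"
| "sat A (Disj I F) e \<longleftrightarrow> (\<exists>i \<in> I. sat A (F i) e)"
| "sat A (Conj I F) e \<longleftrightarrow> (\<forall>i \<in> I. sat A (F i) e)"
| "sat A (Ex x \<phi>) e \<longleftrightarrow> (\<exists>a \<in> univ A. sat A \<phi> (e(x := a)))"
| "sat A (All x \<phi>) e \<longleftrightarrow> (\<forall>a \<in> univ A. sat A \<phi> (e(x := a)))"

primrec finitary_qf :: "fm \<Rightarrow> bool" where
  "finitary_qf (Eq s t) \<longleftrightarrow> True"
| "finitary_qf (Rel R ts) \<longleftrightarrow> True"
| "finitary_qf (Neg \<phi>) \<longleftrightarrow> finitary_qf \<phi>"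
| "finitary_qf (Disj I F) \<longleftrightarrow> finite I \<and> (\<forall>i \<in> I. finitary_qf (F i))"
| "finitary_qf (Conj I F) \<longleftrightarrow> finite I \<and> (\<forall>i \<in> I. finitary_qf (F i))"
| "finitary_qf (Ex x \<phi>) \<longleftrightarrow> False"
| "finitary_qf (All x \<phi>) \<longleftrightarrow> False"

text \<open>The level of the hierarchy is an ordinal represented by a well-order; level zero is the
  empty well-order.\<close>

inductive is_Sigma :: "nat rel \<Rightarrow> fm \<Rightarrow> bool" and is_Pi :: "nat rel \<Rightarrow> fm \<Rightarrow> bool" where
  Sigma_0: "finitary_qf \<phi> \<Longrightarrow> is_Sigma {} \<phi>"
| Pi_0: "finitary_qf \<phi> \<Longrightarrow> is_Pi {} \<phi>"
| Sigma: "Well_order \<gamma> \<Longrightarrow> \<gamma> \<noteq> {} \<Longrightarrow>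
    (\<forall>i \<in> I. \<exists>xs \<psi> \<beta>. F i = foldr Ex xs \<psi> \<and> (\<beta>, \<gamma>) \<in> ordLess \<and> is_Pi \<beta> \<psi>) \<Longrightarrow>
    is_Sigma \<gamma> (Disj I F)"
| Pi: "Well_order \<gamma> \<Longrightarrow> \<gamma> \<noteq> {} \<Longrightarrow>
    (\<forall>i \<in> I. \<exists>xs \<psi> \<beta>. F i = foldr All xs \<psi> \<and> (\<beta>, \<gamma>) \<in> ordLess \<and> is_Sigma \<beta> \<psi>) \<Longrightarrow>
    is_Pi \<gamma> (Conj I F)"

text \<open>As usual for \<open>L\<^sub>\<omega>\<^sub>1\<^sub>\<omega>\<close>, formulas have finitely many free variables, so that
  the values of \<^term>\<open>e\<close> on \<^term>\<open>fv \<phi>\<close> are exactly a finite tuple of parameters.\<close>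

definition elementary_substructure :: "lang \<Rightarrow> nat rel \<Rightarrow> struct \<Rightarrow> struct \<Rightarrow> bool" where
  "elementary_substructure L \<gamma> B A \<longleftrightarrow> substructure L B A \<and>
     (\<forall>\<phi> e. is_Sigma \<gamma> \<phi> \<longrightarrow> fm_in L \<phi> \<longrightarrow> finite (fv \<phi>) \<longrightarrow> e ` fv \<phi> \<subseteq> univ B \<longrightarrow>
        (sat B \<phi> e \<longleftrightarrow> sat A \<phi> e))"

section \<open>Generically and coarsely c.e. structures\<close>

definition asymptotically_dense :: "nat set \<Rightarrow> bool" where
  "asymptotically_dense D \<longleftrightarrow> (\<lambda>n. real (card (D \<inter> {0..n})) / (real n + 1)) \<longlonglongrightarrow> 1"

definition generically_ce :: "lang \<Rightarrow> nat rel \<Rightarrow> struct \<Rightarrow> bool" where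
  "generically_ce L \<gamma> A \<longleftrightarrow>
     (\<exists>D. asymptotically_dense D \<and> ce_set D \<and> ce_structure L (restrict_struct A D) \<and>
        elementary_substructure L \<gamma> (restrict_struct A D) A)"

definition coarsely_ce :: "lang \<Rightarrow> nat rel \<Rightarrow> struct \<Rightarrow> bool" where
  "coarsely_ce L \<gamma> A \<longleftrightarrow>
     (\<exists>D \<E> \<D>. asymptotically_dense D \<and> univ \<E> = UNIV \<and> ce_structure L \<E> \<and> univ \<D> = D \<and>
        elementary_substructure L \<gamma> \<D> A \<and> elementary_substructure L \<gamma> \<D> \<E>)"

section \<open>Linear orderings as structures\<close>

definition order_lang :: lang where
  "order_lang = \<lparr>fun_ar = Map.empty, rel_ar = [0 \<mapsto> 2]\<rparr>"

text \<open>The relation symbol \<open>0\<close> is interpreted by the reflexive order \<^term>\<open>r\<close>; the value of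
  \<^const>\<open>fun_of\<close> is irrelevant as \<^const>\<open>order_lang\<close> has no function symbols.\<close>

definition order_struct :: "nat rel \<Rightarrow> struct" where
  "order_struct r =
     \<lparr>univ = UNIV, fun_of = (\<lambda>_ _. 0), rel_of = (\<lambda>_. {[x, y] | x y. (x, y) \<in> r})\<rparr>"

end

theory Submission
  imports Defs "HOL-Library.Countable" "HOL-Library.Infinite_Set" "HOL-Real_Asymp.Real_Asymp"
begin

text \<open>
  The witness is a copy of the rationals. Any two dense linear orders without endpoints satisfy the
  same infinitary formulas, with parameters that are ordered in the same way, by a back-and-forth
  argument (\<open>sat_transfer\<close>). Hence one such order contained in another is an elementary
  substructure for formulas of all levels of the hierarchy at once, and a single linear order serves
  for every \<open>\<alpha>\<close>.

  Start with a computable dense order without endpoints on \<open>\<omega>\<close>, given by an injective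
  function \<open>dyadic\<close> into the rationals, in which the even numbers are order-dense. Reserve a set \<open>S\<close> of odd
  numbers, of asymptotic density zero, consisting of one pair of numbers for every program
  (\<open>sparse_transversal\<close>, \<open>diagonal_order\<close>). Let the \<open>i\<close>-th pair lie in the field of the relation that the
  \<open>i\<close>-th program enumerates, if this field contains infinitely many odd numbers. The desired order
  arises from the computable one by interchanging the two members of some of these pairs, namely
  whenever this is needed to make the order of the pair disagree with the \<open>i\<close>-th program.

  The complement of \<open>S\<close> has density one, contains all even numbers and is therefore again dense
  without endpoints; on it the old and the new order agree. So it witnesses that the new order is
  coarsely c.e. On the other hand, a set of density one contains infinitely many odd numbers, and the
  diagonalisation has made sure that the new order is not c.e. on any such set.
\<close>

section \<open>Infinitary formulas in dense linear orders without endpoints\<close>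

text \<open>A linear order presented by an injective function into an ordered type, so that passing to a
  subset or permuting the elements changes just one of the two arguments.\<close>

definition key_struct :: "nat set \<Rightarrow> (nat \<Rightarrow> 'k::linorder) \<Rightarrow> struct" where
  "key_struct U k =
     \<lparr>univ = U, fun_of = (\<lambda>_ _. 0), rel_of = (\<lambda>_. {[x, y] | x y. x \<in> U \<and> y \<in> U \<and> k x \<le> k y})\<rparr>"

lemma univ_key_struct [simp]: "univ (key_struct U k) = U"
  by (simp add: key_struct_def)

lemma pair_in_rel_key_struct [simp]:
  "[x, y] \<in> rel_of (key_struct U k) R \<longleftrightarrow> x \<in> U \<and> y \<in> U \<and> k x \<le> k y"
  by (simp add: key_struct_def)

text \<open>Hausdorff's \<open>\<eta>\<^sub>0\<close> property. Taking \<open>X\<close> or \<open>Y\<close> empty shows that such a set is nonempty and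
  has no endpoints, and taking singletons that it is dense.\<close>

definition eta_set :: "'k::linorder set \<Rightarrow> bool" where
  "eta_set K \<longleftrightarrow> (\<forall>X Y. finite X \<longrightarrow> finite Y \<longrightarrow> X \<subseteq> K \<longrightarrow> Y \<subseteq> K \<longrightarrow> (\<forall>x\<in>X. \<forall>y\<in>Y. x < y) \<longrightarrow>
     (\<exists>z\<in>K. (\<forall>x\<in>X. x < z) \<and> (\<forall>y\<in>Y. z < y)))"

lemma eta_set_extend:
  fixes k :: "nat \<Rightarrow> 'k::linorder" and l :: "nat \<Rightarrow> 'l::linorder"
  assumes eta: "eta_set (l ` V)" and "finite F" and "e' ` F \<subseteq> V"
    and same: "\<And>u v. u \<in> F \<Longrightarrow> v \<in> F \<Longrightarrow> k (e u) \<le> k (e v) \<longleftrightarrow> l (e' u) \<le> l (e' v)"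
  shows "\<exists>b\<in>V. \<forall>u\<in>F. (k (e u) \<le> k a \<longleftrightarrow> l (e' u) \<le> l b) \<and> (k a \<le> k (e u) \<longleftrightarrow> l b \<le> l (e' u))"
proof (cases "\<exists>w\<in>F. k (e w) = k a")
  case True
  then obtain w where w: "w \<in> F" "k a = k (e w)" by metis
  then have "e' w \<in> V" using assms(3) by blast
  moreover have "\<forall>u\<in>F. (k (e u) \<le> k a \<longleftrightarrow> l (e' u) \<le> l (e' w)) \<and> (k a \<le> k (e u) \<longleftrightarrow> l (e' w) \<le> l (e' u))"
    unfolding w(2) by (intro ballI conjI same w(1))
  ultimately show ?thesis by blast
next
  case False
  define X where "X = (\<lambda>u. l (e' u)) ` {u \<in> F. k (e u) < k a}"
  define Y where "Y = (\<lambda>u. l (e' u)) ` {u \<in> F. k a < k (e u)}"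
  have "\<forall>x\<in>X. \<forall>y\<in>Y. x < y"
    unfolding X_def Y_def using same by (force simp: not_le[symmetric])
  moreover have "finite X" "finite Y" "X \<subseteq> l ` V" "Y \<subseteq> l ` V"
    using assms(2,3) by (auto simp: X_def Y_def)
  ultimately have "\<exists>z\<in>l ` V. (\<forall>x\<in>X. x < z) \<and> (\<forall>y\<in>Y. z < y)"
    using eta unfolding eta_set_def by (elim allE[of _ X] allE[of _ Y]) simp
  then obtain b where b: "b \<in> V" "\<forall>x\<in>X. x < l b" "\<forall>y\<in>Y. l b < y" by blast
  have "(k (e u) \<le> k a \<longleftrightarrow> l (e' u) \<le> l b) \<and> (k a \<le> k (e u) \<longleftrightarrow> l b \<le> l (e' u))"
    if "u \<in> F" for u
  proof (cases "k (e u) < k a")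
    case True
    then have "l (e' u) < l b" using b(2) that by (auto simp: X_def)
    with True show ?thesis by auto
  next
    case False
    then have "k a < k (e u)"
      using that \<open>\<not> (\<exists>w\<in>F. k (e w) = k a)\<close> by (metis linorder_less_linear)
    moreover from this have "l b < l (e' u)" using b(3) that by (auto simp: Y_def)
    ultimately show ?thesis by auto
  qed
  then show ?thesis using b(1) by blast
qed

lemma trm_in_order_langD: "trm_in order_lang t \<Longrightarrow> \<exists>x. t = Var x"
  by (cases t) (auto simp: order_lang_def)

text \<open>Back and forth: the two quantifier steps use \<open>eta_set_extend\<close> in the two directions.\<close>

lemma sat_transfer:
  fixes k :: "nat \<Rightarrow> 'k::linorder" and l :: "nat \<Rightarrow> 'l::linorder"
  assumes inj: "inj_on k U" "inj_on l V" and eta: "eta_set (k ` U)" "eta_set (l ` V)"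
    and "fm_in order_lang \<phi>" and "finite (fv \<phi>)" and "e ` fv \<phi> \<subseteq> U" and "e' ` fv \<phi> \<subseteq> V"
    and "\<And>u v. u \<in> fv \<phi> \<Longrightarrow> v \<in> fv \<phi> \<Longrightarrow> k (e u) \<le> k (e v) \<longleftrightarrow> l (e' u) \<le> l (e' v)"
  shows "sat (key_struct U k) \<phi> e \<longleftrightarrow> sat (key_struct V l) \<phi> e'"
  using assms(5-)
proof (induction \<phi> arbitrary: e e')
  case (Eq s t)
  then obtain x y where [simp]: "s = Var x" "t = Var y"
    using trm_in_order_langD by (metis fm_in.simps(1))
  have "e x = e y \<longleftrightarrow> k (e x) = k (e y)" using Eq inj(1) by (auto simp: inj_on_def)
  also have "\<dots> \<longleftrightarrow> l (e' x) = l (e' y)"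
    using Eq.prems(5)[of x y] Eq.prems(5)[of y x] by (auto simp: order_eq_iff)
  also have "\<dots> \<longleftrightarrow> e' x = e' y" using Eq inj(2) by (auto simp: inj_on_def)
  finally show ?case by simp
next
  case (Rel R ts)
  have "length ts = 2" using Rel.prems(1) by (auto simp: order_lang_def split: if_splits)
  then obtain s t where ts: "ts = [s, t]"
    by (auto simp: length_Suc_conv numeral_2_eq_2)
  then have "trm_in order_lang s" "trm_in order_lang t" using Rel.prems(1) by simp_all
  then obtain x y where "s = Var x" "t = Var y"
    using trm_in_order_langD by blast
  then show ?case using Rel.prems ts by auto
next
  case (Neg \<phi>)
  then show ?case by simp
next
  case (Disj I F)
  have "sat (key_struct U k) (F i) e \<longleftrightarrow> sat (key_struct V l) (F i) e'" if "i \<in> I" for i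
  proof (rule Disj.IH)
    have sub: "fv (F i) \<subseteq> fv (Disj I F)" using that by auto
    show "finite (fv (F i))" by (rule finite_subset[OF sub Disj.prems(2)])
    show "e ` fv (F i) \<subseteq> U" "e' ` fv (F i) \<subseteq> V"
      using sub Disj.prems(3,4) by (meson image_mono order_trans)+
    show "k (e u) \<le> k (e v) \<longleftrightarrow> l (e' u) \<le> l (e' v)" if "u \<in> fv (F i)" "v \<in> fv (F i)" for u v
      using that sub by (intro Disj.prems(5)) (rule subsetD[OF sub], assumption)+
  qed (use that Disj.prems(1) in auto)
  then show ?case by simp
next
  case (Conj I F)
  have "sat (key_struct U k) (F i) e \<longleftrightarrow> sat (key_struct V l) (F i) e'" if "i \<in> I" for i
  proof (rule Conj.IH)
    have sub: "fv (F i) \<subseteq> fv (Conj I F)" using that by auto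
    show "finite (fv (F i))" by (rule finite_subset[OF sub Conj.prems(2)])
    show "e ` fv (F i) \<subseteq> U" "e' ` fv (F i) \<subseteq> V"
      using sub Conj.prems(3,4) by (meson image_mono order_trans)+
    show "k (e u) \<le> k (e v) \<longleftrightarrow> l (e' u) \<le> l (e' v)" if "u \<in> fv (F i)" "v \<in> fv (F i)" for u v
      using that sub by (intro Conj.prems(5)) (rule subsetD[OF sub], assumption)+
  qed (use that Conj.prems(1) in auto)
  then show ?case by simp
next
  case (Ex x \<phi>)
  note same = Ex.prems(5)
  have step: "sat (key_struct U k) \<phi> (e(x := a)) \<longleftrightarrow> sat (key_struct V l) \<phi> (e'(x := b))"
    if "a \<in> U" "b \<in> V" "\<forall>u\<in>fv (Ex x \<phi>).
      (k (e u) \<le> k a \<longleftrightarrow> l (e' u) \<le> l b) \<and> (k a \<le> k (e u) \<longleftrightarrow> l b \<le> l (e' u))" for a b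
    by (rule Ex.IH) (use that Ex.prems in auto)
  have to_V: "\<exists>b\<in>V. sat (key_struct U k) \<phi> (e(x := a)) \<longleftrightarrow> sat (key_struct V l) \<phi> (e'(x := b))"
    if "a \<in> U" for a
    using eta_set_extend[where k = k and e = e and a = a, OF eta(2) Ex.prems(2,4) same] step that
    by blast
  have to_U: "\<exists>a\<in>U. sat (key_struct U k) \<phi> (e(x := a)) \<longleftrightarrow> sat (key_struct V l) \<phi> (e'(x := b))"
    if "b \<in> V" for b
    using eta_set_extend[where k = l and e = e' and a = b,
        OF eta(1) Ex.prems(2,3) same[symmetric]] step that
    by blast
  from to_V to_U show ?case unfolding sat.simps univ_key_struct by blast
next
  case (All x \<phi>)
  note same = All.prems(5)
  have step: "sat (key_struct U k) \<phi> (e(x := a)) \<longleftrightarrow> sat (key_struct V l) \<phi> (e'(x := b))"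
    if "a \<in> U" "b \<in> V" "\<forall>u\<in>fv (All x \<phi>).
      (k (e u) \<le> k a \<longleftrightarrow> l (e' u) \<le> l b) \<and> (k a \<le> k (e u) \<longleftrightarrow> l b \<le> l (e' u))" for a b
    by (rule All.IH) (use that All.prems in auto)
  have to_V: "\<exists>b\<in>V. sat (key_struct U k) \<phi> (e(x := a)) \<longleftrightarrow> sat (key_struct V l) \<phi> (e'(x := b))"
    if "a \<in> U" for a
    using eta_set_extend[where k = k and e = e and a = a, OF eta(2) All.prems(2,4) same] step that
    by blast
  have to_U: "\<exists>a\<in>U. sat (key_struct U k) \<phi> (e(x := a)) \<longleftrightarrow> sat (key_struct V l) \<phi> (e'(x := b))"
    if "b \<in> V" for b
    using eta_set_extend[where k = l and e = e' and a = b,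
        OF eta(1) All.prems(2,3) same[symmetric]] step that
    by blast
  from to_V to_U show ?case unfolding sat.simps univ_key_struct by blast
qed

lemma is_structure_key_struct: "U \<noteq> {} \<Longrightarrow> is_structure order_lang (key_struct U k)"
  by (auto simp: is_structure_def key_struct_def order_lang_def tuples_def split: if_splits)

lemma eta_set_nonempty: "eta_set K \<Longrightarrow> K \<noteq> {}"
  unfolding eta_set_def by (elim allE[of _ "{}"]) auto

lemma elementary_substructure_key_struct:
  fixes k l :: "nat \<Rightarrow> 'k::linorder"
  assumes "U \<subseteq> V" and "inj_on l V" and "eta_set (k ` U)" and "eta_set (l ` V)"
    and eq: "\<And>x. x \<in> U \<Longrightarrow> k x = l x"
  shows "elementary_substructure order_lang \<gamma> (key_struct U k) (key_struct V l)"
  unfolding elementary_substructure_def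
proof (intro conjI allI impI)
  have "U \<noteq> {}" "V \<noteq> {}" using eta_set_nonempty assms(3,4) by blast+
  then show "substructure order_lang (key_struct U k) (key_struct V l)"
    using assms(1) eq
    by (auto simp: substructure_def is_structure_key_struct)
      (auto simp: key_struct_def order_lang_def tuples_def split: if_splits)
next
  fix \<phi> e
  assume *: "fm_in order_lang \<phi>" "finite (fv \<phi>)" "e ` fv \<phi> \<subseteq> univ (key_struct U k)"
  have "inj_on k U" using assms(1,2) eq by (auto simp: inj_on_def)
  then show "sat (key_struct U k) \<phi> e \<longleftrightarrow> sat (key_struct V l) \<phi> e"
    using * assms by (intro sat_transfer) (auto simp: image_subset_iff)
qed

section \<open>Programs for the computable dense order\<close>

inductive_cases rec_eval_ZeroE: "rec_eval Zero xs y"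
inductive_cases rec_eval_SuccE: "rec_eval Succ xs y"
inductive_cases rec_eval_ProjE: "rec_eval (Proj i) xs y"
inductive_cases rec_eval_CompE: "rec_eval (Comp f gs) xs y"
inductive_cases rec_eval_Prec_0E: "rec_eval (Prec f g) (0 # xs) y"
inductive_cases rec_eval_Prec_SucE: "rec_eval (Prec f g) (Suc n # xs) y"
inductive_cases rec_eval_MuE: "rec_eval (Mu f) xs y"

lemma rec_eval_determ: "rec_eval f xs y \<Longrightarrow> rec_eval f xs z \<Longrightarrow> y = z"
proof (induction arbitrary: z rule: rec_eval.induct)
  case (Comp xs gs ys f w)
  from Comp.prems obtain zs where zs: "list_all2 (\<lambda>g y. rec_eval g xs y) gs zs" "rec_eval f zs z"
    by (rule rec_eval_CompE)
  have "ys = zs"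
    using Comp.IH(1) zs(1) by (auto simp: list_all2_conv_all_nth intro: nth_equalityI)
  then show ?case using Comp.IH(2) zs(2) by blast
next
  case (Prec_Suc f g n xs y w)
  from Prec_Suc.prems show ?case
    by (rule rec_eval_Prec_SucE) (use Prec_Suc.IH in blast)
next
  case (Mu f n xs)
  from Mu.prems have "rec_eval f (z # xs) 0" "\<forall>m<z. \<exists>y. rec_eval f (m # xs) (Suc y)"
    by (auto elim: rec_eval_MuE)
  with Mu.IH show ?case by (metis Zero_not_Suc nat_neq_iff)
qed (blast elim: rec_eval_ZeroE rec_eval_SuccE rec_eval_ProjE rec_eval_Prec_0E)+

lemma rec_eval_Proj: "i < length xs \<Longrightarrow> y = xs ! i \<Longrightarrow> rec_eval (Proj i) xs y"
  using Proj by blast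

lemma rec_eval_Succ: "y = Suc x \<Longrightarrow> rec_eval Succ [x] y"
  using Succ by blast

lemma rec_eval_Comp1: "rec_eval g xs y \<Longrightarrow> rec_eval f [y] z \<Longrightarrow> rec_eval (Comp f [g]) xs z"
  by (rule Comp[of _ _ "[y]"]) auto

lemma rec_eval_Comp2:
  "rec_eval g xs y \<Longrightarrow> rec_eval h xs y' \<Longrightarrow> rec_eval f [y, y'] z \<Longrightarrow> rec_eval (Comp f [g, h]) xs z"
  by (rule Comp[of _ _ "[y, y']"]) auto

definition "add_prog = Prec (Proj 0) (Comp Succ [Proj 1])"
definition "mult_prog = Prec Zero (Comp add_prog [Proj 1, Proj 2])"
definition "pred_prog = Prec Zero (Proj 0)"

text \<open>Recursion runs along the first argument, so the subtrahend comes first.\<close>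

definition "monus_prog = Prec (Proj 0) (Comp pred_prog [Proj 1])"

lemma rec_eval_add: "z = x + y \<Longrightarrow> rec_eval add_prog [x, y] z"
  unfolding add_prog_def
proof (induction x arbitrary: z)
  case 0
  then show ?case by (auto intro!: Prec_0 rec_eval_Proj)
next
  case (Suc x)
  show ?case
    by (rule Prec_Suc[OF Suc.IH[OF refl]])
      (auto simp: Suc.prems intro!: rec_eval_Comp1 rec_eval_Succ rec_eval_Proj)
qed

lemma rec_eval_mult: "z = x * y \<Longrightarrow> rec_eval mult_prog [x, y] z"
  unfolding mult_prog_def
proof (induction x arbitrary: z)
  case 0
  then show ?case by (auto intro!: Prec_0 Zero)
next
  case (Suc x)
  show ?case
    by (rule Prec_Suc[OF Suc.IH[OF refl]])
      (rule rec_eval_Comp2 rec_eval_Proj rec_eval_add refl | simp add: Suc.prems)+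
qed

lemma rec_eval_pred: "z = x - 1 \<Longrightarrow> rec_eval pred_prog [x] z"
  unfolding pred_prog_def
proof (induction x arbitrary: z)
  case 0
  then show ?case by (auto intro!: Prec_0 Zero)
next
  case (Suc x)
  show ?case
    by (rule Prec_Suc[OF Suc.IH[OF refl]]) (auto simp: Suc.prems intro!: rec_eval_Proj)
qed

lemma rec_eval_monus: "z = x - y \<Longrightarrow> rec_eval monus_prog [y, x] z"
  unfolding monus_prog_def
proof (induction y arbitrary: z)
  case 0
  then show ?case by (auto intro!: Prec_0 rec_eval_Proj)
next
  case (Suc y)
  show ?case
    by (rule Prec_Suc[OF Suc.IH[OF refl]])
      (rule rec_eval_Comp1[OF rec_eval_Proj rec_eval_pred], auto simp: Suc.prems)
qed

text \<open>The largest power of two that is at most \<open>n + 1\<close>.\<close>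

primrec pow2_below :: "nat \<Rightarrow> nat" where
  "pow2_below 0 = 1"
| "pow2_below (Suc n) = (if n + 2 = 2 * pow2_below n then n + 2 else pow2_below n)"

lemma pow2_below_bounds: "\<exists>k. pow2_below n = 2 ^ k \<and> 2 ^ k \<le> n + 1 \<and> n + 1 < 2 ^ Suc k"
proof (induction n)
  case 0
  show ?case by (rule exI[of _ 0]) simp
next
  case (Suc n)
  then obtain k where k: "pow2_below n = 2 ^ k" "2 ^ k \<le> n + 1" "n + 1 < 2 ^ Suc k" by blast
  show ?case
  proof (cases "n + 2 = 2 * pow2_below n")
    case True
    then show ?thesis using k by (intro exI[of _ "Suc k"]) auto
  next
    case False
    then show ?thesis using k by (intro exI[of _ k]) auto
  qed
qed

lemma pow2_below_eq:
  assumes "2 ^ k \<le> n + 1" and "n + 1 < 2 ^ Suc k"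
  shows "pow2_below n = 2 ^ k"
proof -
  obtain j where j: "pow2_below n = 2 ^ j" "2 ^ j \<le> n + 1" "n + 1 < 2 ^ Suc j"
    using pow2_below_bounds by blast
  have "(2::nat) ^ k < 2 ^ Suc j" "(2::nat) ^ j < 2 ^ Suc k" using assms j by linarith+
  then have "k < Suc j" "j < Suc k" using power_less_imp_less_exp one_less_numeral_iff
    by (metis semiring_norm(76))+
  then show ?thesis using j by simp
qed

text \<open>The value of the recursion step is \<open>p + p * (1 - (2 * p - (n + 2)))\<close> with truncated
  subtraction; since \<open>n + 1 < 2 * p\<close>, the second summand is \<open>p\<close> if \<open>n + 2 = 2 * p\<close> and
  \<open>0\<close> otherwise.\<close>

definition "pow2_step_prog =
  Comp add_prog [Proj 1, Comp mult_prog [Proj 1,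
    Comp monus_prog [Comp monus_prog [Comp Succ [Comp Succ [Proj 0]], Comp add_prog [Proj 1, Proj 1]],
      Comp Succ [Zero]]]]"
definition "pow2_prog = Prec (Comp Succ [Zero]) pow2_step_prog"

lemma rec_eval_pow2_step:
  "z = p + p * (1 - (2 * p - (n + 2))) \<Longrightarrow> rec_eval pow2_step_prog [n, p] z"
  unfolding pow2_step_prog_def
  by (rule rec_eval_Comp2 rec_eval_Comp1 rec_eval_Proj rec_eval_add rec_eval_mult rec_eval_monus
      rec_eval_Succ Zero refl | simp add: mult_2)+

lemma rec_eval_pow2: "rec_eval pow2_prog [n] (pow2_below n)"
proof (induction n)
  case 0
  show ?case unfolding pow2_prog_def
    by (auto intro!: Prec_0 rec_eval_Comp1 rec_eval_Succ Zero)
next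
  case (Suc n)
  obtain k where "pow2_below n = 2 ^ k" "2 ^ k \<le> n + 1" "n + 1 < 2 ^ Suc k"
    using pow2_below_bounds by blast
  then have "pow2_below (Suc n) = pow2_below n + pow2_below n * (1 - (2 * pow2_below n - (n + 2)))"
    by auto
  then show ?case unfolding pow2_prog_def
    using Suc by (intro Prec_Suc[OF _ rec_eval_pow2_step]) (auto simp: pow2_prog_def)
qed

text \<open>A computable bijection between \<open>\<omega>\<close> and the dyadic rationals strictly between \<open>2\<close> and \<open>4\<close>:
  the numbers \<open>n\<close> with \<^term>\<open>pow2_below n = 2 ^ k\<close> list the odd multiples of
  \<open>1 / 2 ^ k\<close> in this interval.\<close>

definition dyadic :: "nat \<Rightarrow> real" where
  "dyadic n = real (2 * n + 3) / real (pow2_below n)"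

lemma pow2_below_pos: "0 < pow2_below n"
  using pow2_below_bounds[of n] by auto

lemma dyadic_le_iff:
  "dyadic x \<le> dyadic y \<longleftrightarrow> (2 * x + 3) * pow2_below y \<le> (2 * y + 3) * pow2_below x"
proof -
  have "dyadic x \<le> dyadic y \<longleftrightarrow>
      real (2 * x + 3) * real (pow2_below y) \<le> real (2 * y + 3) * real (pow2_below x)"
    unfolding dyadic_def using pow2_below_pos[of x] pow2_below_pos[of y]
    by (simp add: divide_simps mult.commute)
  then show ?thesis by (simp only: of_nat_mult[symmetric] of_nat_le_iff)
qed

text \<open>\<^const>\<open>Mu\<close> searches for a zero of a function that does not depend on the search variable: it
  halts iff the truncated difference of the two sides of \<open>dyadic_le_iff\<close> vanishes.\<close>

definition "twice_plus3_prog i =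
  Comp Succ [Comp Succ [Comp Succ [Comp add_prog [Proj i, Proj i]]]]"
definition "diff_prog =
  Comp monus_prog [Comp mult_prog [twice_plus3_prog 2, Comp pow2_prog [Proj 1]],
    Comp mult_prog [twice_plus3_prog 1, Comp pow2_prog [Proj 2]]]"

lemma rec_eval_diff:
  "rec_eval diff_prog [m, x, y] ((2 * x + 3) * pow2_below y - (2 * y + 3) * pow2_below x)"
  unfolding diff_prog_def twice_plus3_prog_def
  by (rule rec_eval_Comp2 rec_eval_Comp1 rec_eval_Proj rec_eval_add rec_eval_mult rec_eval_monus
      rec_eval_Succ rec_eval_pow2 Zero refl | simp add: algebra_simps)+

lemma ce_structure_dyadic: "ce_structure order_lang (key_struct UNIV dyadic)"
proof -
  have halts: "(\<exists>n. rec_eval (Mu diff_prog) [x, y] n) \<longleftrightarrow> dyadic x \<le> dyadic y" for x y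
  proof
    assume "\<exists>n. rec_eval (Mu diff_prog) [x, y] n"
    then obtain n where "rec_eval diff_prog [n, x, y] 0" by (auto elim: rec_eval_MuE)
    from rec_eval_determ[OF this rec_eval_diff] show "dyadic x \<le> dyadic y"
      by (simp add: dyadic_le_iff)
  next
    assume "dyadic x \<le> dyadic y"
    then have "rec_eval diff_prog [0, x, y] 0"
      using rec_eval_diff[of 0 x y] by (simp add: dyadic_le_iff)
    then show "\<exists>n. rec_eval (Mu diff_prog) [x, y] n" by (auto intro!: exI[of _ 0] Mu)
  qed
  have "ce_rel 2 {[x, y] | x y. dyadic x \<le> dyadic y}"
    unfolding ce_rel_def
    by (intro conjI exI[of _ "Mu diff_prog"])
      (auto simp: length_Suc_conv numeral_2_eq_2 halts[symmetric])
  moreover have "ce_set UNIV"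
    unfolding ce_set_def ce_rel_def
    by (auto simp: length_Suc_conv intro!: exI[of _ Zero] exI[of _ 0] rec_eval.Zero)
  ultimately show ?thesis
    by (auto simp: ce_structure_def is_structure_key_struct)
      (auto simp: key_struct_def order_lang_def split: if_splits)
qed

text \<open>The numerators are odd, so equal values have the same power of two as denominator.\<close>

lemma inj_dyadic: "inj dyadic"
proof (rule injI)
  fix x y
  assume "dyadic x = dyadic y"
  then have "(2 * x + 3) * pow2_below y = (2 * y + 3) * pow2_below x"
    using dyadic_le_iff[of x y] dyadic_le_iff[of y x] by simp
  moreover obtain j k where "pow2_below x = 2 ^ j" "pow2_below y = 2 ^ k"
    using pow2_below_bounds by blast
  ultimately have eq: "(2 * x + 3) * 2 ^ k = (2 * y + 3) * 2 ^ j" by simp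
  have impossible: "\<not> i < l" if "(2 * u + 3) * 2 ^ l = (2 * v + 3) * 2 ^ i" for u v i l :: nat
  proof
    assume "i < l"
    then obtain d where "l = i + Suc d" using less_imp_Suc_add by auto
    with that have "(2 * u + 3) * (2 * 2 ^ d) * 2 ^ i = (2 * v + 3) * 2 ^ i"
      by (simp add: power_add ac_simps)
    then have "(2 * u + 3) * (2 * 2 ^ d) = 2 * v + 3" by (simp only: mult_cancel2) simp
    moreover have "even ((2 * u + 3) * (2 * 2 ^ d))" "odd (2 * v + 3)" by simp_all
    ultimately show False by metis
  qed
  have "j = k" using impossible[OF eq] impossible[OF eq[symmetric]] by simp
  with eq show "x = y" by simp
qed

lemma dyadic_bounds: "2 < dyadic n" "dyadic n < 4"
proof -
  obtain k where k: "pow2_below n = 2 ^ k" "2 ^ k \<le> n + 1" "n + 1 < 2 ^ Suc k"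
    using pow2_below_bounds by blast
  then have "2 * 2 ^ k < 2 * n + 3" "2 * n + 3 < 4 * 2 ^ k" by auto
  then have "real (2 * 2 ^ k) < real (2 * n + 3)" "real (2 * n + 3) < real (4 * 2 ^ k)"
    by (simp_all only: of_nat_less_iff)
  then show "2 < dyadic n" "dyadic n < 4"
    unfolding dyadic_def k(1) by (simp_all add: divide_simps)
qed

lemma dyadic_even_dense:
  assumes "2 \<le> a" and "a < b" and "b \<le> 4"
  shows "\<exists>n. even n \<and> a < dyadic n \<and> dyadic n < b"
proof -
  obtain k where k: "4 / (b - a) < 2 ^ k"
    using real_arch_pow[of 2 "4 / (b - a)"] by auto
  then have gap: "a * 2 ^ k + 4 < b * 2 ^ k"
    using assms(2) by (simp add: field_simps)
  \<comment> \<open>An even \<open>n = 2 * j\<close> has numerator \<open>4 * j + 3\<close>.\<close>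
  define j where "j = \<lfloor>(a * 2 ^ k - 3) / 4\<rfloor> + 1"
  have j: "a * 2 ^ k < 4 * of_int j + 3" "4 * of_int j + 3 < b * 2 ^ k"
    using of_int_floor_le[of "(a * 2 ^ k - 3) / 4"]
      real_of_int_floor_add_one_gt[of "(a * 2 ^ k - 3) / 4"] gap
    unfolding j_def by (simp_all add: field_simps)
  have low: "2 * 2 ^ k \<le> a * 2 ^ k" and high: "b * 2 ^ k \<le> 4 * 2 ^ k"
    using assms by (simp_all add: mult_right_mono)
  have "(1::real) \<le> 2 ^ k" by simp
  then have "0 \<le> j" using j(1) low by linarith
  then obtain i where i: "j = int i" using nonneg_int_cases by blast
  have "2 * 2 ^ k < 4 * real i + 3" "4 * real i + 3 < 4 * 2 ^ k"
    using j low high unfolding i of_int_of_nat_eq by linarith+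
  then have "real (2 * 2 ^ k) < real (4 * i + 3)" "real (4 * i + 3) < real (4 * 2 ^ k)"
    by simp_all
  then have "2 * 2 ^ k < 4 * i + 3" "4 * i + 3 < 4 * 2 ^ k"
    by (simp_all only: of_nat_less_iff)
  then have "2 ^ k \<le> 2 * i + 1" "2 * i + 1 < 2 ^ Suc k" by simp_all
  then have "pow2_below (2 * i) = 2 ^ k" by (intro pow2_below_eq) simp_all
  then have "a < dyadic (2 * i)" "dyadic (2 * i) < b"
    using j unfolding i dyadic_def by (simp_all add: field_simps)
  then show ?thesis by (intro exI[of _ "2 * i"]) simp
qed

text \<open>Adjoining the unattained bounds \<open>2\<close> and \<open>4\<close> to the two finite sets turns an empty set into a
  nonempty one, so that the absence of endpoints is a case of density.\<close>

lemma eta_set_dyadic: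
  assumes "{n. even n} \<subseteq> U"
  shows "eta_set (dyadic ` U)"
  unfolding eta_set_def
proof (intro allI impI)
  fix X Y
  assume fin: "finite X" "finite Y" and XY: "X \<subseteq> dyadic ` U" "Y \<subseteq> dyadic ` U"
    "\<forall>x\<in>X. \<forall>y\<in>Y. x < y"
  have X: "finite (insert 2 X)" "insert 2 X \<noteq> {}" and Y: "finite (insert 4 Y)" "insert 4 Y \<noteq> {}"
    using fin by auto
  have "Max (insert 2 X) < Min (insert 4 Y)"
    unfolding Max_less_iff[OF X] Min_gr_iff[OF Y] using XY dyadic_bounds by force
  moreover have "2 \<le> Max (insert 2 X)" "Min (insert 4 Y) \<le> 4" using fin by simp_all
  ultimately obtain n where n: "even n" "Max (insert 2 X) < dyadic n" "dyadic n < Min (insert 4 Y)"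
    using dyadic_even_dense by blast
  then have "(\<forall>x\<in>X. x < dyadic n) \<and> (\<forall>y\<in>Y. dyadic n < y)"
    unfolding Max_less_iff[OF X] Min_gr_iff[OF Y] by blast
  then show "\<exists>z\<in>dyadic ` U. (\<forall>x\<in>X. x < z) \<and> (\<forall>y\<in>Y. z < y)"
    using n(1) assms by blast
qed

section \<open>Asymptotic density\<close>

text \<open>The even numbers have density \<open>1 / 2\<close>, so they cannot make up almost all of \<open>D\<close>.\<close>

lemma asymptotically_dense_infinite_odd:
  assumes "asymptotically_dense D"
  shows "infinite (D \<inter> {n. odd n})"
proof
  assume fin: "finite (D \<inter> {n. odd n})"
  define c where "c = card (D \<inter> {n. odd n})"
  have "card (D \<inter> {0..n}) \<le> c + (n div 2 + 1)" for n
  proof -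
    have "D \<inter> {0..n} \<subseteq> D \<inter> {n. odd n} \<union> (\<lambda>i. 2 * i) ` {0..n div 2}"
      by (auto elim!: evenE)
    then have "card (D \<inter> {0..n}) \<le> card (D \<inter> {n. odd n} \<union> (\<lambda>i. 2 * i) ` {0..n div 2})"
      using fin by (intro card_mono) auto
    also have "\<dots> \<le> c + card ((\<lambda>i. 2 * i) ` {0..n div 2})"
      unfolding c_def by (rule card_Un_le)
    also have "\<dots> \<le> c + (n div 2 + 1)"
      using card_image_le[of "{0..n div 2}" "\<lambda>i. 2 * i"] by simp
    finally show ?thesis .
  qed
  then have "real (card (D \<inter> {0..n})) \<le> real (c + (n div 2 + 1))" for n
    by (rule of_nat_mono)
  moreover have "real (c + (n div 2 + 1)) \<le> real c + (real n / 2 + 1)" for n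
    by simp
  ultimately have "real (card (D \<inter> {0..n})) \<le> real c + (real n / 2 + 1)" for n
    by (rule order_trans)
  then have "real (card (D \<inter> {0..n})) / (real n + 1) \<le> (real c + (real n / 2 + 1)) / (real n + 1)"
    for n by (simp add: divide_right_mono)
  moreover have "(\<lambda>n. (real c + (real n / 2 + 1)) / (real n + 1)) \<longlonglongrightarrow> 1 / 2"
    by real_asymp
  ultimately have "(1::real) \<le> 1 / 2"
    using assms unfolding asymptotically_dense_def by (intro LIMSEQ_le) auto
  then show False by simp
qed

text \<open>At most \<open>sqrt n + 1\<close> of the values of \<open>s\<close> are bounded by \<open>n\<close>.\<close>

lemma asymptotically_dense_compl_range:
  assumes "\<And>i. i ^ 2 \<le> s i"
  shows "asymptotically_dense (- range s)"
proof -
  have lower: "real n - sqrt (real n) \<le> real (card (- range s \<inter> {0..n}))" for n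
  proof -
    have "range s \<inter> {0..n} \<subseteq> s ` {0..nat \<lfloor>sqrt (real n)\<rfloor>}"
    proof
      fix x
      assume "x \<in> range s \<inter> {0..n}"
      then obtain i where i: "x = s i" "s i \<le> n" by auto
      then have "i ^ 2 \<le> n" using assms[of i] by linarith
      then have "real i ^ 2 \<le> real n" by (metis of_nat_le_iff of_nat_power)
      then have "real i \<le> sqrt (real n)" by (rule real_le_rsqrt)
      then have "i \<le> nat \<lfloor>sqrt (real n)\<rfloor>" by (simp add: le_nat_floor)
      then show "x \<in> s ` {0..nat \<lfloor>sqrt (real n)\<rfloor>}" using i by auto
    qed
    then have "card (range s \<inter> {0..n}) \<le> card {0..nat \<lfloor>sqrt (real n)\<rfloor>}"
      by (intro surj_card_le) auto
    then have "real (card (range s \<inter> {0..n})) \<le> real (nat \<lfloor>sqrt (real n)\<rfloor> + 1)"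
      by (intro of_nat_mono) simp
    also have "\<dots> \<le> sqrt (real n) + 1" by simp
    finally have "real (card (range s \<inter> {0..n})) \<le> sqrt (real n) + 1" .
    moreover have "card {0..n} = card (range s \<inter> {0..n}) + card (- range s \<inter> {0..n})"
    proof -
      have "{0..n} = (range s \<inter> {0..n}) \<union> (- range s \<inter> {0..n})" by auto
      then have "card {0..n} = card ((range s \<inter> {0..n}) \<union> (- range s \<inter> {0..n}))"
        by (rule arg_cong)
      also have "\<dots> = card (range s \<inter> {0..n}) + card (- range s \<inter> {0..n})"
        by (rule card_Un_disjoint) auto
      finally show ?thesis .
    qed
    ultimately show ?thesis by simp
  qed
  have upper: "real (card (- range s \<inter> {0..n})) \<le> real n + 1" for n
    using card_mono[of "{0..n}" "- range s \<inter> {0..n}"] by simp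
  show ?thesis
    unfolding asymptotically_dense_def
  proof (rule real_tendsto_sandwich)
    show "\<forall>\<^sub>F n in sequentially. (real n - sqrt (real n)) / (real n + 1)
        \<le> real (card (- range s \<inter> {0..n})) / (real n + 1)"
      using lower by (simp add: divide_right_mono)
    show "\<forall>\<^sub>F n in sequentially. real (card (- range s \<inter> {0..n})) / (real n + 1) \<le> 1"
      using upper by (simp add: divide_simps)
    show "(\<lambda>n. (real n - sqrt (real n)) / (real n + 1)) \<longlonglongrightarrow> 1" by real_asymp
  qed simp
qed

lemma sparse_transversal:
  fixes V :: "nat \<Rightarrow> nat set"
  assumes "\<And>i. infinite (V i)"
  obtains s :: "nat \<Rightarrow> nat" where "strict_mono s" "\<And>i. s i \<in> V i" "\<And>i. i ^ 2 \<le> s i"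
proof -
  have "\<exists>s. \<forall>i. (s i \<in> V i \<and> i ^ 2 \<le> s i) \<and> s i < s (Suc i)"
  proof (rule dependent_nat_choice)
    show "\<exists>x. x \<in> V 0 \<and> 0 ^ 2 \<le> x" using assms[of 0] by (auto dest: infinite_imp_nonempty)
    fix x i
    obtain y where "y \<in> V (Suc i)" "max (Suc x) (Suc i ^ 2) \<le> y"
      using assms[of "Suc i"] unfolding infinite_nat_iff_unbounded_le by blast
    then show "\<exists>y. (y \<in> V (Suc i) \<and> Suc i ^ 2 \<le> y) \<and> x < y" by (intro exI[of _ y]) auto
  qed
  then show ?thesis using that by (auto simp: strict_mono_Suc_iff)
qed

section \<open>Diagonalisation against c.e. relations\<close>

instance recf :: countable
  by countable_datatype

lemma ce_rel_enumeration:
  obtains R :: "nat \<Rightarrow> nat list set" where "\<And>Q. ce_rel n Q \<Longrightarrow> \<exists>i. Q = R i"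
proof
  fix Q
  assume "ce_rel n Q"
  then obtain f where "Q = {xs. length xs = n \<and> (\<exists>y. rec_eval f xs y)}"
    unfolding ce_rel_def by blast
  then show "\<exists>i. Q = {xs. length xs = n \<and> (\<exists>y. rec_eval (from_nat i) xs y)}"
    by (intro exI[of _ "to_nat f"]) simp
qed

text \<open>The points with indices \<open>2 * i\<close> and \<open>2 * i + 1\<close> form the \<open>i\<close>-th pair, and \<open>I\<close> collects the
  pairs whose members are interchanged.\<close>

definition swap_pairs :: "(nat \<Rightarrow> nat) \<Rightarrow> nat set \<Rightarrow> nat \<Rightarrow> nat" where
  "swap_pairs s I n =
     (if \<exists>j. n = s j \<and> j div 2 \<in> I
      then let j = inv s n in s (if even j then j + 1 else j - 1) else n)"

lemma swap_pairs_notin_range: "n \<notin> range s \<Longrightarrow> swap_pairs s I n = n"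
  by (auto simp: swap_pairs_def)

lemma swap_pairs_at:
  assumes "inj s"
  shows "swap_pairs s I (s j) = s (if j div 2 \<in> I then if even j then j + 1 else j - 1 else j)"
  using assms by (auto simp: swap_pairs_def inj_eq)

lemma swap_pairs_involution:
  assumes "inj s"
  shows "swap_pairs s I (swap_pairs s I n) = n"
proof (cases "n \<in> range s")
  case True
  then obtain j where "n = s j" by blast
  then show ?thesis by (auto simp: swap_pairs_at[OF assms] elim!: oddE)
qed (simp add: swap_pairs_notin_range)

lemma bij_swap_pairs: "inj s \<Longrightarrow> bij (swap_pairs s I)"
  by (rule o_bij[of "swap_pairs s I"]) (auto simp: swap_pairs_involution)

text \<open>A reflexive order on \<open>D\<close> determines \<open>D\<close>. So if the \<open>i\<close>-th relation is the new order on a set \<open>D\<close>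
  that meets \<open>T\<close> infinitely often, then the \<open>i\<close>-th pair was chosen inside \<open>D\<close>; but it has been
  reversed exactly if the \<open>i\<close>-th relation agreed with its original order. The quadratic growth of
  \<open>s\<close> keeps the set of moved points sparse.\<close>

lemma diagonal_order:
  fixes k :: "nat \<Rightarrow> 'k::linorder" and T :: "nat set"
  assumes "inj k" and "infinite T"
  obtains s \<pi> :: "nat \<Rightarrow> nat" where
    "range s \<subseteq> T" "\<And>i. i ^ 2 \<le> s i" "bij \<pi>" "\<And>n. n \<notin> range s \<Longrightarrow> \<pi> n = n"
    "\<And>D. infinite (D \<inter> T) \<Longrightarrow> \<not> ce_rel 2 {[x, y] | x y. x \<in> D \<and> y \<in> D \<and> k (\<pi> x) \<le> k (\<pi> y)}"
proof -
  obtain R :: "nat \<Rightarrow> nat list set" where R: "\<And>Q. ce_rel 2 Q \<Longrightarrow> \<exists>i. Q = R i"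
    using ce_rel_enumeration by blast
  \<comment> \<open>If the field of \<open>R i\<close> has only finitely many points in \<open>T\<close>, there is nothing to diagonalise
    against, and any pair from \<open>T\<close> will do.\<close>
  define W where "W i = {x. [x, x] \<in> R i} \<inter> T" for i
  define V where "V i = (if infinite (W i) then W i else T)" for i
  have "infinite (V (i div 2))" for i using assms(2) by (auto simp: V_def)
  then obtain s where s: "strict_mono s" "\<And>i. s i \<in> V (i div 2)" "\<And>i. i ^ 2 \<le> s i"
    using sparse_transversal[of "\<lambda>i. V (i div 2)"] by blast
  have "inj s" using s(1) by (rule strict_mono_imp_inj_on)
  define I where "I = {i. [s (2 * i), s (2 * i + 1)] \<in> R i \<longleftrightarrow> k (s (2 * i)) \<le> k (s (2 * i + 1))}"
  define \<pi> where "\<pi> = swap_pairs s I"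
  have "range s \<subseteq> T" using s(2) by (force simp: V_def W_def split: if_splits)
  moreover have "\<not> ce_rel 2 {[x, y] | x y. x \<in> D \<and> y \<in> D \<and> k (\<pi> x) \<le> k (\<pi> y)}" (is "\<not> ce_rel 2 ?Q")
    if "infinite (D \<inter> T)" for D
  proof
    assume "ce_rel 2 ?Q"
    then obtain i where i: "?Q = R i" using R by blast
    have "W i = D \<inter> T" unfolding W_def i[symmetric] by auto
    then have "V i = D \<inter> T" using that by (simp add: V_def)
    moreover define x y where "x = s (2 * i)" and "y = s (2 * i + 1)"
    ultimately have "x \<in> D" "y \<in> D" using s(2)[of "2 * i"] s(2)[of "2 * i + 1"] by auto
    then have "[x, y] \<in> R i \<longleftrightarrow> k (\<pi> x) \<le> k (\<pi> y)" unfolding i[symmetric] by auto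
    moreover have "k x \<noteq> k y"
      using assms(1) \<open>inj s\<close> by (simp add: x_def y_def inj_eq)
    moreover have "\<pi> x = (if i \<in> I then y else x)" "\<pi> y = (if i \<in> I then x else y)"
      by (simp_all add: \<pi>_def swap_pairs_at[OF \<open>inj s\<close>] x_def y_def)
    moreover have "i \<in> I \<longleftrightarrow> ([x, y] \<in> R i \<longleftrightarrow> k x \<le> k y)" by (simp add: I_def x_def y_def)
    ultimately show False by (auto split: if_splits)
  qed
  ultimately show ?thesis
    using that[of s \<pi>] s(3) bij_swap_pairs[OF \<open>inj s\<close>] swap_pairs_notin_range
    unfolding \<pi>_def by blast
qed

theorem proposition4p2:
  fixes \<alpha> :: "nat rel"
  assumes "computable_ordinal \<alpha>"
  shows "\<exists>r :: nat rel. linear_order r \<and>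
    coarsely_ce order_lang (ord_succ (ord_succ \<alpha>)) (order_struct r) \<and>
    \<not> generically_ce order_lang (ord_succ (ord_succ \<alpha>)) (order_struct r)"
proof -
  \<comment> \<open>The complement of the set of squares has density one.\<close>
  have "infinite {n :: nat. odd n}"
    using asymptotically_dense_infinite_odd[OF asymptotically_dense_compl_range[of "\<lambda>i. i ^ 2"]]
    by (auto intro: finite_subset)
  with inj_dyadic obtain s \<pi> where
    s: "range s \<subseteq> {n. odd n}" "\<And>i. i ^ 2 \<le> s i" and
    \<pi>: "bij \<pi>" "\<And>n. n \<notin> range s \<Longrightarrow> \<pi> n = n" and
    diag: "\<And>D. infinite (D \<inter> {n. odd n}) \<Longrightarrow>
      \<not> ce_rel 2 {[x, y] | x y. x \<in> D \<and> y \<in> D \<and> dyadic (\<pi> x) \<le> dyadic (\<pi> y)}"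
    by (rule diagonal_order) blast
  define k where "k = dyadic \<circ> \<pi>"
  define r where "r = {(x, y). k x \<le> k y}"
  define D where "D = - range s"
  have A: "order_struct r = key_struct UNIV k"
    by (simp add: order_struct_def key_struct_def r_def)
  have "inj k" unfolding k_def by (rule inj_compose[OF inj_dyadic bij_is_inj[OF \<pi>(1)]])
  have "linear_order r"
    unfolding linear_order_on_def partial_order_on_def preorder_on_def r_def
    using \<open>inj k\<close> by (auto simp: refl_on_def trans_def antisym_def total_on_def dest: injD)
  moreover have "coarsely_ce order_lang \<gamma> (order_struct r)" for \<gamma>
    unfolding coarsely_ce_def
  proof (intro exI conjI)
    show "asymptotically_dense D"
      unfolding D_def using s(2) by (rule asymptotically_dense_compl_range)
    show "ce_structure order_lang (key_struct UNIV dyadic)" by (rule ce_structure_dyadic)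
    have "range k = range dyadic"
      unfolding k_def using \<pi>(1) by (metis bij_is_surj image_comp)
    moreover have "eta_set (dyadic ` D)" "eta_set (range dyadic)"
      using s(1) by (auto simp: D_def intro!: eta_set_dyadic)
    ultimately show "elementary_substructure order_lang \<gamma> (key_struct D dyadic) (order_struct r)"
      and "elementary_substructure order_lang \<gamma> (key_struct D dyadic) (key_struct UNIV dyadic)"
      unfolding A using \<open>inj k\<close> inj_dyadic \<pi>(2)
      by (auto intro!: elementary_substructure_key_struct simp: k_def D_def)
  qed simp_all
  moreover have "\<not> generically_ce order_lang \<gamma> (order_struct r)" for \<gamma>
  proof
    assume "generically_ce order_lang \<gamma> (order_struct r)"
    then obtain D' where D': "asymptotically_dense D'"
      "ce_structure order_lang (restrict_struct (order_struct r) D')"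
      unfolding generically_ce_def by blast
    have "ce_rel 2 (rel_of (restrict_struct (order_struct r) D') 0)"
      using D'(2) by (simp add: ce_structure_def order_lang_def)
    also have "rel_of (restrict_struct (order_struct r) D') 0 =
        {[x, y] | x y. x \<in> D' \<and> y \<in> D' \<and> dyadic (\<pi> x) \<le> dyadic (\<pi> y)}"
      by (auto simp: restrict_struct_def order_struct_def r_def k_def)
    finally show False using diag asymptotically_dense_infinite_odd[OF D'(1)] by blast
  qed
  ultimately show ?thesis by blast
qed

end
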